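(* Let $$M = \begin{bmatrix} A_{1,1} & A_{1,2} & 0\\ A_{2,1} & a_{2,2} & A_{2,3}\\ 0 & A_{3,2} & A_{3,3}\end{bmatrix}$$ be a sign pattern matrix, where $A_{1,1}$ is $m_1\times n_1$, $A_{1,2}$ is $m_1\times 1$, $A_{2,1}$ is $1\times n_1$, $a_{2,2}$ is $1\times 1$, $A_{2,3}$ is $1\times n_2$, $A_{3,2}$ is $m_2\times 1$, and $A_{3,3}$ is $m_2\times n_2$. For $p\in\{+,-,0\}$, let $$R_p = \begin{bmatrix} A_{1,1} & A_{1,2}\\ A_{2,1} & p\end{bmatrix}\quad\text{and}\quad S_p = \begin{bmatrix} a_{2,2}-p & A_{2,3}\\ A_{3,2} & A_{3,3}\end{bmatrix},$$ where $S_p$ may be a generalized sign pattern matrix. Then $$\begin{aligned}\operatorname{mr}(M) = \min\Big\{ & \operatorname{mr}(A_{1,1})+\operatorname{mr}(A_{3,3})+2,\\ & \operatorname{mr}([A_{1,1}\;A_{1,2}])+\operatorname{mr}([A_{3,2}\;A_{3,3}])+1,\\ & \operatorname{mr}\left(\begin{bmatrix} A_{1,1} \\ A_{2,1} \end{bmatrix}\right)+\operatorname{mr}\left(\begin{bmatrix} A_{2,3} \\ A_{3,3} \end{bmatrix}\right)+1,\\ & \operatorname{mr}(R_+)+\operatorname{mr}(S_+),\\ & \operatorname{mr}(R_0)+\operatorname{mr}(S_0),\\ & \operatorname{mr}(R_-)+\operatorname{mr}(S_-)\Big\}.\end{aligned}$$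
   Context: A sign pattern matrix is a matrix with entries in $\{+,-,0\}$. A generalized sign pattern matrix is a matrix with entries in $\{+,-,0,\#\}$. For a (generalized) sign pattern matrix $A=[a_{i,j}]$, $Q(A)$ is the set of all real matrices $B=[b_{i,j}]$ of the same size such that $b_{i,j}$ is positive, negative, zero if $a_{i,j}$ is $+$, $-$, $0$ respectively, and $b_{i,j}$ is an arbitrary real number if $a_{i,j}=\#$. The minimum rank $\operatorname{mr}(A)$ is the minimum of the ranks of the matrices in $Q(A)$. Subtraction of two elements of $\{+,-,0\}$, with values in $\{+,-,0,\#\}$, is defined by: $(+)-(0)=+$, $(0)-(-)=+$, $(+)-(-)=+$; $(-)-(+)=-$, $(0)-(+)=-$, $(-)-(0)=-$; $(0)-(0)=0$; $(+)-(+)=\#$, $(-)-(-)=\#$. The blocks written $0$ in $M$ are blocks all of whose entries are $0$. *)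

theory Defs
  imports "HOL-Analysis.Analysis"
begin

datatype gsign = SPlus | SMinus | SZero | SHash

definition sign_pattern :: "gsign^'n^'m \<Rightarrow> bool" where
  "sign_pattern A \<longleftrightarrow> (\<forall>i j. A $ i $ j \<in> {SPlus, SMinus, SZero})"

fun sign_reals :: "gsign \<Rightarrow> real set" where
  "sign_reals SPlus = {x. x > 0}"
| "sign_reals SMinus = {x. x < 0}"
| "sign_reals SZero = {0}"
| "sign_reals SHash = UNIV"

definition qual_class :: "gsign^'n^'m \<Rightarrow> (real^'n^'m) set" where
  "qual_class A = {B. \<forall>i j. B $ i $ j \<in> sign_reals (A $ i $ j)}"

definition mr :: "gsign^'n^'m \<Rightarrow> nat" where
  "mr A = (LEAST r. \<exists>B \<in> qual_class A. rank B = r)"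

text \<open>Subtraction is meant for operands other than \<open>SHash\<close>; the last two
  equations only make the function total.\<close>

fun sign_diff :: "gsign \<Rightarrow> gsign \<Rightarrow> gsign" where
  "sign_diff SPlus SZero = SPlus"
| "sign_diff SZero SMinus = SPlus"
| "sign_diff SPlus SMinus = SPlus"
| "sign_diff SMinus SPlus = SMinus"
| "sign_diff SZero SPlus = SMinus"
| "sign_diff SMinus SZero = SMinus"
| "sign_diff SZero SZero = SZero"
| "sign_diff SPlus SPlus = SHash"
| "sign_diff SMinus SMinus = SHash"
| "sign_diff SHash _ = SHash"
| "sign_diff _ SHash = SHash"

text \<open>Block matrices are indexed by sum types: \<open>A ||| B\<close> is the matrix \<open>[A B]\<close>, and
  \<open>A /// B\<close> is \<open>A\<close> stacked on top of \<open>B\<close>; \<open>|||\<close> binds more tightly. Hence an index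
  type \<open>'n1 + 1 + 'n2\<close> describes a division into \<open>CARD('n1)\<close>, one and \<open>CARD('n2)\<close>
  columns.\<close>

definition hcat :: "'a^'n1^'m \<Rightarrow> 'a^'n2^'m \<Rightarrow> 'a^('n1 + 'n2)^'m" (infixr \<open>|||\<close> 65) where
  "A ||| B = (\<chi> i j. case j of Inl k \<Rightarrow> A $ i $ k | Inr k \<Rightarrow> B $ i $ k)"

definition vcat :: "'a^'n^'m1 \<Rightarrow> 'a^'n^'m2 \<Rightarrow> 'a^'n^('m1 + 'm2)" (infixr \<open>'/'/'/\<close> 60) where
  "A /// B = (\<chi> i. case i of Inl k \<Rightarrow> A $ k | Inr k \<Rightarrow> B $ k)"

definition zero_block :: "gsign^'n^'m" where
  "zero_block = (\<chi> i j. SZero)"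

definition entry :: "'a \<Rightarrow> 'a^1^1" where
  "entry a = (\<chi> i j. a)"

end

theory Submission
  imports Defs
begin

text \<open>For the lower bound take a matrix of minimum rank in the class of \<open>M\<close>, with real blocks \<open>B\<close>.
  If \<open>B12\<close> lies in the column space and \<open>B21\<close> in the row space of \<open>B11\<close>, there is a
  unique entry \<open>p\<close> that can be put below \<open>B12\<close> without raising the rank of \<open>B11\<close>; eliminating
  with \<open>B11\<close> splits the rank of the whole as that of the completed upper left block plus that of the
  lower right block with corner \<open>b - p\<close>. The same works from the other end with \<open>B33\<close>. Otherwise each of
  \<open>B11\<close>, \<open>B33\<close> has a bordering row or column that raises its rank, and block triangular
  submatrices give one of the first three terms. The upper bounds are subadditivity of the
  rank, after rescaling the two summands so that the corner entries add up to the right sign.\<close>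

section \<open>Block matrices indexed by sum types\<close>

lemma sum_UNIV_sum:
  "(\<Sum>k\<in>UNIV. f k) = (\<Sum>k\<in>UNIV. f (Inl k)) + (\<Sum>k\<in>UNIV. f (Inr k))"
  for f :: "'a::finite + 'b::finite \<Rightarrow> 'c::comm_monoid_add"
proof -
  have "(\<Sum>k\<in>UNIV. f k) = (\<Sum>k\<in>UNIV <+> UNIV. f k)" by simp
  also have "\<dots> = (\<Sum>k\<in>UNIV. f (Inl k)) + (\<Sum>k\<in>UNIV. f (Inr k))"
    by (subst sum.Plus) (simp_all add: o_def)
  finally show ?thesis .
qed

lemma hcat_nth [simp]: "(A ||| B) $ i $ Inl k = A $ i $ k" "(A ||| B) $ i $ Inr l = B $ i $ l"
  by (simp_all add: hcat_def)

lemma vcat_nth [simp]: "(A /// B) $ Inl k = A $ k" "(A /// B) $ Inr l = B $ l"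
  by (simp_all add: vcat_def)

lemma entry_nth [simp]: "entry a $ i $ j = a"
  by (simp add: entry_def)

lemma all_sum: "(\<forall>i. P i) \<longleftrightarrow> (\<forall>k. P (Inl k)) \<and> (\<forall>l. P (Inr l))"
  by (metis sum.exhaust)

lemma vcat_hcat: "((A ||| B) /// (C ||| D)) = ((A /// C) ||| (B /// D))"
  by (simp add: vec_eq_iff all_sum)

lemma entry_eta: "entry (X $ 1 $ 1) = X" for X :: "'a^1^1"
  by (simp add: vec_eq_iff forall_1)

lemma hcat_exhaust: obtains X Y where "Z = X ||| Y"
proof
  show "Z = (\<chi> i k. Z $ i $ Inl k) ||| (\<chi> i l. Z $ i $ Inr l)"
    by (simp add: vec_eq_iff all_sum)
qed

lemma vcat_exhaust: obtains X Y where "Z = (X /// Y)"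
proof
  show "Z = ((\<chi> k. Z $ Inl k) /// (\<chi> l. Z $ Inr l))"
    by (simp add: vec_eq_iff all_sum)
qed

lemma mult_hcat: "A ** (X ||| Y) = (A ** X) ||| (A ** Y)"
  by (simp add: vec_eq_iff all_sum matrix_matrix_mult_def)

lemma vcat_mult: "(A /// B) ** X = ((A ** X) /// (B ** X))"
  by (simp add: vec_eq_iff all_sum matrix_matrix_mult_def)

lemma transpose_vcat: "transpose (A /// B) = transpose A ||| transpose B"
  by (simp add: vec_eq_iff all_sum transpose_def)

lemma hcat_diff: "(A ||| B) - (C ||| D) = (A - C) ||| (B - D)"
  by (simp add: vec_eq_iff all_sum)

lemma vcat_diff: "(A /// B) - (C /// D) = ((A - C) /// (B - D))"
  by (simp add: vec_eq_iff all_sum)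

lemma entry_diff: "entry a - entry b = entry (a - b)"
  by (simp add: vec_eq_iff)

lemma matrix_mult_zero: "A ** (0 :: 'a::semiring_1^'p^'n) = 0"
  by (simp add: vec_eq_iff matrix_matrix_mult_def)

lemma zero_matrix_mult: "(0 :: 'a::semiring_1^'n^'m) ** A = 0"
  by (simp add: vec_eq_iff matrix_matrix_mult_def)

lemma hcat_mult_vec:
  "(A ||| B) *v z = A *v (\<chi> k. z $ Inl k) + B *v (\<chi> l. z $ Inr l)"
  by (simp add: vec_eq_iff matrix_vector_mult_def sum_UNIV_sum)

lemma vcat_mult_vec_nth:
  "((A /// B) *v x) $ Inl i = (A *v x) $ i" "((A /// B) *v x) $ Inr j = (B *v x) $ j"
  by (simp_all add: matrix_vector_mult_def)

lemma range_hcat: "A *v x + B *v y \<in> range ((*v) (A ||| B))"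
proof
  show "A *v x + B *v y =
      (A ||| B) *v (\<chi> k. case k of Inl i \<Rightarrow> x $ i | Inr j \<Rightarrow> y $ j)"
    by (simp add: hcat_mult_vec)
qed simp

section \<open>Rank under sums, scaling and selection of rows and columns\<close>

text \<open>The range of a sum lies in the sum of the ranges. Naming the sum \<open>C\<close> and
  the bounds \<open>a\<close>, \<open>b\<close> lets each use split into a decomposition and two
  rank estimates.\<close>

lemma rank_add_le:
  fixes A B C :: "real^'n^'m"
  assumes "C = A + B" "rank A \<le> a" "rank B \<le> b"
  shows "rank C \<le> a + b"
proof -
  have "rank C \<le> dim {x + y |x y. x \<in> range ((*v) A) \<and> y \<in> range ((*v) B)}"
    unfolding rank_dim_range
    by (rule dim_subset) (auto simp: assms(1) matrix_vector_mult_add_rdistrib)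
  also have "\<dots> \<le> rank A + rank B"
    using dim_sums_Int[of "range ((*v) A)" "range ((*v) B)"]
    by (simp add: rank_dim_range linear_subspace_image)
  finally show ?thesis using assms by linarith
qed

text \<open>Scaling is multiplication by a scalar matrix, so it cannot raise the rank; a nonzero
  factor can be undone.\<close>

lemma rank_scaleR: "c \<noteq> 0 \<Longrightarrow> rank (c *\<^sub>R A) = rank A" for A :: "real^'n^'m"
proof -
  have le: "rank (d *\<^sub>R B) \<le> rank B" for d and B :: "real^'n^'m"
  proof -
    have "d *\<^sub>R B = B ** (\<chi> i j. if i = j then d else 0)"
      by (simp add: vec_eq_iff matrix_matrix_mult_def if_distrib[of "\<lambda>x. _ * x"] mult.commute
            cong: if_cong)
    then show ?thesis by (metis rank_mul_le_left)
  qed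
  assume "c \<noteq> 0"
  then have "A = inverse c *\<^sub>R (c *\<^sub>R A)" by simp
  then show ?thesis using le by (metis le_antisym)
qed

text \<open>\<open>B\<close> is \<open>P ** A ** Q\<close> with selection matrices of entries 0 and
  1; \<open>None\<close> marks a row or column of zeros. One rule thus covers submatrices,
  permutations of blocks and zero padding.\<close>

lemma rank_partial_reindex_le:
  fixes A :: "real^'n^'m" and B :: "real^'q^'p"
  assumes "\<And>i j. B $ i $ j =
    (case f i of None \<Rightarrow> 0 | Some k \<Rightarrow> (case g j of None \<Rightarrow> 0 | Some l \<Rightarrow> A $ k $ l))"
  shows "rank B \<le> rank A"
proof -
  define P :: "real^'m^'p" where "P = (\<chi> i k. if f i = Some k then 1 else 0)"
  define Q :: "real^'q^'n" where "Q = (\<chi> l j. if g j = Some l then 1 else 0)"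
  have "B $ i $ j = (P ** A ** Q) $ i $ j" for i j
  proof -
    have "(P ** A ** Q) $ i $ j = (\<Sum>l\<in>UNIV. (\<Sum>k\<in>UNIV. P $ i $ k * A $ k $ l) * Q $ l $ j)"
      by (simp add: matrix_matrix_mult_def)
    also have "\<dots> = B $ i $ j"
      by (cases "f i"; cases "g j")
         (simp_all add: assms P_def Q_def if_distrib[of "\<lambda>x. x * _"] if_distrib[of "\<lambda>x. _ * x"]
            cong: if_cong)
    finally show ?thesis ..
  qed
  then have "B = P ** A ** Q" by (simp add: vec_eq_iff)
  then show ?thesis
    by (metis le_trans rank_mul_le_left rank_mul_le_right)
qed

lemma rank_reindex_le:
  fixes A :: "real^'n^'m" and B :: "real^'q^'p"
  assumes "\<And>i j. B $ i $ j = A $ f i $ g j"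
  shows "rank B \<le> rank A"
  by (rule rank_partial_reindex_le[where f="Some \<circ> f" and g="Some \<circ> g"]) (simp add: assms)

section \<open>Bordered matrices and Schur complements\<close>

text \<open>Adjoining a vector to the columns raises the dimension of their span exactly when it
  lies outside that span. The criterion is put as solvability of \<open>c = A ** x\<close>, so that
  transposition yields the row version and \<open>x\<close> can serve for elimination.\<close>

lemma rank_hcat_column:
  fixes A :: "real^'n^'m" and c :: "real^1^'m"
  shows "rank (A ||| c) = (if \<exists>x. c = A ** x then rank A else rank A + 1)"
proof -
  have one: "l = 1" for l :: 1
    by (rule num1_eq1)
  have "columns (A ||| c) = insert (column 1 c) (columns A)"
  proof -
    have "column (Inl k) (A ||| c) = column k A" "column (Inr l) (A ||| c) = column 1 c" for k l
      by (simp_all add: column_def vec_eq_iff one[of l])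
    then show ?thesis
      unfolding columns_def
      by (auto; metis sum.exhaust)
  qed
  moreover have "column 1 c \<in> span (columns A) \<longleftrightarrow> (\<exists>x. c = A ** x)"
  proof
    assume "column 1 c \<in> span (columns A)"
    also have "span (columns A) = range ((*v) A)"
    proof
      show "span (columns A) \<subseteq> range ((*v) A)"
        by (rule span_minimal) (auto simp: columns_image_basis linear_subspace_image)
      show "range ((*v) A) \<subseteq> span (columns A)"
        by (auto simp: matrix_vector_mult_in_columnspace)
    qed
    finally obtain v where v: "column 1 c = A *v v" by auto
    have "c $ i $ j = (A ** (\<chi> k l. v $ k)) $ i $ j" for i j
      using arg_cong[OF v, of "\<lambda>u. u $ i"]
      by (simp add: column_def matrix_vector_mult_def matrix_matrix_mult_def one[of j])
    then show "\<exists>x. c = A ** x" by (metis vec_eq_iff)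
  next
    assume "\<exists>x. c = A ** x"
    then obtain x where "c = A ** x" ..
    then have "column 1 c = A *v column 1 x"
      by (simp add: vec_eq_iff column_def matrix_vector_mult_def matrix_matrix_mult_def)
    then show "column 1 c \<in> span (columns A)"
      by (simp add: matrix_vector_mult_in_columnspace)
  qed
  ultimately show ?thesis
    by (simp add: column_rank_def dim_insert)
qed

lemma rank_vcat_row:
  fixes A :: "real^'n^'m" and r :: "real^'n^1"
  shows "rank (A /// r) = (if \<exists>y. r = y ** A then rank A else rank A + 1)"
proof -
  have "(\<exists>x. transpose r = transpose A ** x) \<longleftrightarrow> (\<exists>y. r = y ** A)"
    by (metis matrix_transpose_mul transpose_transpose)
  then show ?thesis
    using rank_hcat_column[of "transpose A" "transpose r"]
    by (simp add: transpose_vcat[symmetric] rank_transpose)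
qed

text \<open>The image of the row space of \<open>A\<close> under the first block column has dimension \<open>rank A\<close> and is
  independent of the vectors \<open>(0, (D - C ** X) *v y)\<close>, which lie in the range too.\<close>

lemma rank_schur:
  fixes A :: "real^'n^'m" and D :: "real^'q^'p"
  shows "rank A + rank (D - C ** X) \<le> rank ((A ||| A ** X) /// (C ||| D))"
proof -
  let ?M = "(A ||| A ** X) /// (C ||| D)"
  let ?U = "span (rows A)"
  let ?Z = "(0 :: real^'q^'m) /// (D - C ** X)"
  let ?W1 = "(*v) (A /// C) ` ?U"
  let ?W2 = "range ((*v) ?Z)"
  have fst0: "A *v x = 0" if "(A /// C) *v x = ?Z *v y" for x y
  proof -
    have "(A *v x) $ i = 0" for i
      using arg_cong[OF that, of "\<lambda>v. v $ Inl i"] by (simp add: vcat_mult_vec_nth)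
    then show ?thesis by (simp add: vec_eq_iff)
  qed
  have inj0: "x = 0" if "x \<in> ?U" "A *v x = 0" for x
    using matrix_vector_mul_injective_on_rowspace[of A x 0] that by (simp add: span_zero)
  have "inj_on ((*v) (A /// C)) ?U"
  proof (rule inj_onI)
    fix x y assume xy: "x \<in> ?U" "y \<in> ?U" "(A /// C) *v x = (A /// C) *v y"
    have "(A *v x) $ i = (A *v y) $ i" for i
      using arg_cong[OF xy(3), of "\<lambda>v. v $ Inl i"] by (simp add: vcat_mult_vec_nth)
    then have "A *v x = A *v y" by (simp add: vec_eq_iff)
    with xy show "x = y" by (blast intro: matrix_vector_mul_injective_on_rowspace)
  qed
  then have "inj_on ((*v) (A /// C)) (span ?U)" by (simp add: span_span)
  then have 1: "dim ?W1 = rank A"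
    using dim_image_eq[of "(*v) (A /// C)" "?U"] by (simp add: row_rank_def span_span)
  have 2: "rank (D - C ** X) \<le> dim ?W2"
    unfolding rank_dim_range[symmetric]
    by (rule rank_reindex_le[where f=Inr and g=id]) simp
  \<comment> \<open>A common vector has upper part 0 because \<open>?Z\<close> does. So it is
    \<open>(A /// C) *v x\<close> with \<open>A *v x = 0\<close> and \<open>x\<close> in the row
    space, where \<open>A\<close> is injective; hence \<open>x = 0\<close>.\<close>
  have "?W1 \<inter> ?W2 \<subseteq> {0}"
    using fst0 inj0 by (fastforce simp: span_zero)
  then have "dim (?W1 \<inter> ?W2) = 0" by simp
  moreover have "subspace ?W1" "subspace ?W2"
    by (simp_all add: linear_subspace_image)
  ultimately have "dim ?W1 + dim ?W2 = dim {x + y |x y. x \<in> ?W1 \<and> y \<in> ?W2}"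
    using dim_sums_Int[of ?W1 ?W2] by linarith
  also have "\<dots> \<le> rank ?M"
    unfolding rank_dim_range vcat_hcat
  proof (intro dim_subset subsetI)
    fix w assume "w \<in> {x + y |x y. x \<in> ?W1 \<and> y \<in> ?W2}"
    then obtain x y where "w = (A /// C) *v x + ?Z *v y" by auto
    \<comment> \<open>\<open>?Z\<close> is the second block column minus the first one times
      \<open>X\<close>, so \<open>w\<close> is a combination of the columns of
      \<open>?M\<close>.\<close>
    also have "?Z = (A ** X /// D) - (A /// C) ** X"
      by (simp add: vcat_mult vcat_diff)
    finally have "w = (A /// C) *v (x - X *v y) + (A ** X /// D) *v y"
      by (simp add: algebra_simps matrix_vector_mul_assoc)
    then show "w \<in> range ((*v) ((A /// C) ||| (A ** X /// D)))"
      using range_hcat by metis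
  qed
  finally show ?thesis using 1 2 by linarith
qed

lemma rank_block_triangular:
  "rank A + rank B \<le> rank ((A ||| 0) /// (C ||| B))"
  for A :: "real^'n^'m" and B :: "real^'q^'p"
  using rank_schur[of A B C 0] by (simp add: matrix_mult_zero)

section \<open>Upper bounds for the rank of two overlapping blocks\<close>

text \<open>The real counterpart of \<open>M\<close>: two diagonal blocks that share only the corner
  entry \<open>b\<close>. Every matrix in the class of \<open>M\<close> has this form.\<close>

definition overlap ::
  "real^'n1^'m1 \<Rightarrow> real^1^'m1 \<Rightarrow> real^'n1^1 \<Rightarrow> real \<Rightarrow> real^'n2^1 \<Rightarrow> real^1^'m2 \<Rightarrow> real^'n2^'m2
    \<Rightarrow> real^('n1 + 1 + 'n2)^('m1 + 1 + 'm2)" where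
  "overlap B11 B12 B21 b B23 B32 B33 =
    ((B11 ||| B12 ||| 0) /// (B21 ||| entry b ||| B23) /// (0 ||| B32 ||| B33))"

text \<open>Splitting the corner writes the matrix as the sum of its two diagonal blocks, each
  padded by zeros, and padding does not raise the rank.\<close>

lemma rank_overlap_le_entry:
  "rank (overlap B11 B12 B21 (p + q) B23 B32 B33)
    \<le> rank ((B11 ||| B12) /// (B21 ||| entry p)) + rank ((entry q ||| B23) /// (B32 ||| B33))"
proof (rule rank_add_le)
  show "overlap B11 B12 B21 (p + q) B23 B32 B33
      = overlap B11 B12 B21 p 0 0 0 + overlap 0 0 0 q B23 B32 B33" (is "_ = ?R + ?S")
    by (simp add: overlap_def vec_eq_iff all_sum)
  show "rank ?R \<le> rank ((B11 ||| B12) /// (B21 ||| entry p))"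
    by (rule rank_partial_reindex_le
        [where f="case_sum (Some \<circ> Inl) (case_sum (Some \<circ> Inr) (\<lambda>_. None))"
          and g="case_sum (Some \<circ> Inl) (case_sum (Some \<circ> Inr) (\<lambda>_. None))"])
       (simp add: overlap_def hcat_def vcat_def split: sum.split)
  show "rank ?S \<le> rank ((entry q ||| B23) /// (B32 ||| B33))"
    by (rule rank_partial_reindex_le
        [where f="case_sum (\<lambda>_. None) Some"
          and g="case_sum (\<lambda>_. None) Some"])
       (simp add: overlap_def hcat_def vcat_def split: sum.split)
qed

text \<open>The middle row alone has rank at most 1, so it can be cleared at the cost of
  one.\<close>

lemma rank_overlap_middle_row:
  "rank (overlap B11 B12 B21 b B23 B32 B33) \<le> rank (overlap B11 B12 0 0 0 B32 B33) + 1"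
proof (rule rank_add_le)
  show "overlap B11 B12 B21 b B23 B32 B33
      = overlap B11 B12 0 0 0 B32 B33 + overlap 0 0 B21 b B23 0 0" (is "_ = ?R + ?S")
    by (simp add: overlap_def vec_eq_iff all_sum)
  show "rank ?R \<le> rank (overlap B11 B12 0 0 0 B32 B33)"
    by simp
  show "rank ?S \<le> 1"
  proof -
    have "rank ?S \<le> rank (B21 ||| entry b ||| B23)"
      by (rule rank_partial_reindex_le
          [where f="case_sum (\<lambda>_. None) (case_sum Some (\<lambda>_. None))"
            and g="Some"])
         (simp add: overlap_def hcat_def vcat_def split: sum.split)
    then show ?thesis
      using rank_bound[of "B21 ||| entry b ||| B23"] by simp
  qed
qed

lemma rank_overlap_middle_column:
  "rank (overlap B11 B12 B21 b B23 B32 B33) \<le> rank (overlap B11 0 B21 0 B23 0 B33) + 1"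
proof (rule rank_add_le)
  show "overlap B11 B12 B21 b B23 B32 B33
      = overlap B11 0 B21 0 B23 0 B33 + overlap 0 B12 0 b 0 B32 0" (is "_ = ?R + ?S")
    by (simp add: overlap_def vec_eq_iff all_sum)
  show "rank ?R \<le> rank (overlap B11 0 B21 0 B23 0 B33)"
    by simp
  show "rank ?S \<le> 1"
  proof -
    have "rank ?S \<le> rank (B12 /// entry b /// B32)"
      by (rule rank_partial_reindex_le
          [where f="Some"
            and g="case_sum (\<lambda>_. None) (case_sum Some (\<lambda>_. None))"])
         (simp add: overlap_def hcat_def vcat_def split: sum.split)
    then show ?thesis
      using rank_bound[of "B12 /// entry b /// B32"] by simp
  qed
qed

lemma rank_overlap_le_rows:
  "rank (overlap B11 B12 B21 b B23 B32 B33) \<le> rank (B11 ||| B12) + rank (B32 ||| B33) + 1"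
proof -
  have "rank (overlap B11 B12 0 0 0 B32 B33) \<le> rank (B11 ||| B12) + rank (B32 ||| B33)"
  proof (rule rank_add_le)
    show "overlap B11 B12 0 0 0 B32 B33
        = overlap B11 B12 0 0 0 0 0 + overlap 0 0 0 0 0 B32 B33" (is "_ = ?R + ?S")
      by (simp add: overlap_def vec_eq_iff all_sum)
    show "rank ?R \<le> rank (B11 ||| B12)"
      by (rule rank_partial_reindex_le
          [where f="case_sum Some (\<lambda>_. None)"
            and g="case_sum (Some \<circ> Inl) (case_sum (Some \<circ> Inr) (\<lambda>_. None))"])
         (simp add: overlap_def hcat_def vcat_def split: sum.split)
    show "rank ?S \<le> rank (B32 ||| B33)"
      by (rule rank_partial_reindex_le
          [where f="case_sum (\<lambda>_. None) (case_sum (\<lambda>_. None) Some)"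
            and g="case_sum (\<lambda>_. None) Some"])
         (simp add: overlap_def hcat_def vcat_def split: sum.split)
  qed
  then show ?thesis
    using rank_overlap_middle_row[of B11 B12 B21 b B23 B32 B33] by linarith
qed

lemma rank_overlap_le_columns:
  "rank (overlap B11 B12 B21 b B23 B32 B33) \<le> rank (B11 /// B21) + rank (B23 /// B33) + 1"
proof -
  have "rank (overlap B11 0 B21 0 B23 0 B33) \<le> rank (B11 /// B21) + rank (B23 /// B33)"
  proof (rule rank_add_le)
    show "overlap B11 0 B21 0 B23 0 B33
        = overlap B11 0 B21 0 0 0 0 + overlap 0 0 0 0 B23 0 B33" (is "_ = ?R + ?S")
      by (simp add: overlap_def vec_eq_iff all_sum)
    show "rank ?R \<le> rank (B11 /// B21)"
      by (rule rank_partial_reindex_le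
          [where f="case_sum (Some \<circ> Inl) (case_sum (Some \<circ> Inr) (\<lambda>_. None))"
            and g="case_sum Some (\<lambda>_. None)"])
         (simp add: overlap_def hcat_def vcat_def split: sum.split)
    show "rank ?S \<le> rank (B23 /// B33)"
      by (rule rank_partial_reindex_le
          [where f="case_sum (\<lambda>_. None) Some"
            and g="case_sum (\<lambda>_. None) (case_sum (\<lambda>_. None) Some)"])
         (simp add: overlap_def hcat_def vcat_def split: sum.split)
  qed
  then show ?thesis
    using rank_overlap_middle_column[of B11 B12 B21 b B23 B32 B33] by linarith
qed

text \<open>Clearing the middle row costs one and clearing the middle column one more; what is left
  is \<open>B11\<close> and \<open>B33\<close> padded by zeros.\<close>

lemma rank_overlap_le_corners:
  "rank (overlap B11 B12 B21 b B23 B32 B33) \<le> rank B11 + rank B33 + 2"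
proof -
  have "rank (B11 /// (0 :: real^_^1)) \<le> rank B11"
    by (rule rank_partial_reindex_le[where f="case_sum Some (\<lambda>_. None)" and g=Some])
       (simp add: vcat_def split: sum.split)
  moreover have "rank ((0 :: real^_^1) /// B33) \<le> rank B33"
    by (rule rank_partial_reindex_le[where f="case_sum (\<lambda>_. None) Some" and g=Some])
       (simp add: vcat_def split: sum.split)
  ultimately show ?thesis
    using rank_overlap_middle_row[of B11 B12 B21 b B23 B32 B33]
      rank_overlap_le_columns[of B11 B12 0 0 0 B32 B33]
    by linarith
qed

section \<open>Lower bounds for the rank of two overlapping blocks\<close>

text \<open>Reversing the block order of rows and columns exchanges the two ends, so arguments about
  \<open>B11\<close> also serve for \<open>B33\<close>.\<close>

lemma rank_overlap_reverse:
  "rank (overlap B33 B32 B23 b B21 B12 B11) \<le> rank (overlap B11 B12 B21 b B23 B32 B33)"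
  by (rule rank_reindex_le
      [where f="case_sum (Inr \<circ> Inr) (case_sum (Inr \<circ> Inl) Inl)"
        and g="case_sum (Inr \<circ> Inr) (case_sum (Inr \<circ> Inl) Inl)"])
     (simp add: overlap_def hcat_def vcat_def split: sum.split)

lemma rank_overlap_reverse_entry:
  "rank ((B33 ||| B32) /// (B23 ||| entry p)) = rank ((entry p ||| B23) /// (B32 ||| B33))"
  for B33 :: "real^'n^'m"
  by (rule le_antisym; rule rank_reindex_le[where f="case_sum Inr Inl" and g="case_sum Inr Inl"])
     (simp_all add: hcat_def vcat_def split: sum.split)

lemma rank_overlap_ge_entry:
  assumes x: "B12 = B11 ** x" and y: "B21 = y ** B11"
  obtains p where "rank ((B11 ||| B12) /// (B21 ||| entry p))
    + rank ((entry (b - p) ||| B23) /// (B32 ||| B33))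
    \<le> rank (overlap B11 B12 B21 b B23 B32 B33)"
proof
  \<comment> \<open>For the bordering column to be the combination \<open>x\<close> of the columns
    of \<open>B11 /// B21\<close>, its corner entry must be \<open>B21 ** x\<close>.\<close>
  define p where "p = (B21 ** x) $ 1 $ 1"
  have p: "entry p = B21 ** x"
    unfolding p_def by (rule entry_eta)
  have "(B11 ||| B12) /// (B21 ||| entry p) = (B11 /// B21) ||| ((B11 /// B21) ** x)"
    by (simp add: p x vcat_hcat vcat_mult)
  then have "rank ((B11 ||| B12) /// (B21 ||| entry p)) = rank B11"
    using y by (auto simp: rank_hcat_column rank_vcat_row)
  moreover have "rank B11 + rank ((entry (b - p) ||| B23) /// (B32 ||| B33))
    \<le> rank (overlap B11 B12 B21 b B23 B32 B33)"
  proof -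
    \<comment> \<open>This is the Schur complement of \<open>B11\<close> in the whole matrix: the
      subtracted product vanishes outside the corner, where it equals \<open>p\<close>.\<close>
    have "((entry (b - p) ||| B23) /// (B32 ||| B33))
      = ((entry b ||| B23) /// (B32 ||| B33)) - (B21 /// 0) ** (x ||| 0)"
      by (simp add: mult_hcat vcat_mult hcat_diff vcat_diff matrix_mult_zero zero_matrix_mult
          entry_diff vcat_hcat flip: p)
    moreover have "overlap B11 B12 B21 b B23 B32 B33
      = ((B11 ||| B11 ** (x ||| 0)) /// ((B21 /// 0) ||| ((entry b ||| B23) /// (B32 ||| B33))))"
      unfolding overlap_def
      by (simp only: x mult_hcat matrix_mult_zero flip: vcat_hcat)
    ultimately show ?thesis
      using rank_schur[of B11 _ "B21 /// 0" "x ||| 0"] by metis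
  qed
  ultimately show "rank ((B11 ||| B12) /// (B21 ||| entry p))
    + rank ((entry (b - p) ||| B23) /// (B32 ||| B33))
    \<le> rank (overlap B11 B12 B21 b B23 B32 B33)" by simp
qed

text \<open>With the middle column joined to \<open>B11\<close> and the middle row joined to
  \<open>B33\<close>, the matrix is block lower triangular; only the column indices need
  reassociating.\<close>

lemma rank_overlap_ge_corners:
  "rank (B11 ||| B12) + rank (B23 /// B33) \<le> rank (overlap B11 B12 B21 b B23 B32 B33)"
proof -
  have "rank (((B11 ||| B12) ||| 0) /// (((B21 ||| entry b) /// (0 ||| B32)) ||| (B23 /// B33)))
    \<le> rank (overlap B11 B12 B21 b B23 B32 B33)"
    by (rule rank_reindex_le[where f=id and g="case_sum (case_sum Inl (Inr \<circ> Inl)) (Inr \<circ> Inr)"])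
       (simp add: overlap_def hcat_def vcat_def split: sum.split)
  then show ?thesis
    using rank_block_triangular order_trans by blast
qed

lemma rank_overlap_ge_delete_row:
  "rank (B11 ||| B12) + rank B33 \<le> rank (overlap B11 B12 B21 b B23 B32 B33)"
proof -
  have "rank (((B11 ||| B12) ||| 0) /// ((0 ||| B32) ||| B33))
    \<le> rank (overlap B11 B12 B21 b B23 B32 B33)"
    by (rule rank_reindex_le[where f="case_sum Inl (Inr \<circ> Inr)"
          and g="case_sum (case_sum Inl (Inr \<circ> Inl)) (Inr \<circ> Inr)"])
       (simp add: overlap_def hcat_def vcat_def split: sum.split)
  then show ?thesis
    using rank_block_triangular order_trans by blast
qed

text \<open>Once the middle column is deleted, listing the rows and columns of \<open>B33\<close>
  first gives a block lower triangular matrix.\<close>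

lemma rank_overlap_ge_delete_column:
  "rank (B11 /// B21) + rank B33 \<le> rank (overlap B11 B12 B21 b B23 B32 B33)"
proof -
  have "rank ((B33 ||| 0) /// ((0 /// B23) ||| (B11 /// B21)))
    \<le> rank (overlap B11 B12 B21 b B23 B32 B33)"
    by (rule rank_reindex_le[where f="case_sum (Inr \<circ> Inr) (case_sum Inl (Inr \<circ> Inl))"
          and g="case_sum (Inr \<circ> Inr) Inl"])
       (simp add: overlap_def hcat_def vcat_def split: sum.split)
  then show ?thesis
    using rank_block_triangular[of B33 "B11 /// B21" "0 /// B23"] by linarith
qed

lemma rank_hcat_commute: "rank (A ||| B) = rank (B ||| A)" for A :: "real^'n^'m"
  by (rule le_antisym; rule rank_reindex_le[where f=id and g="case_sum Inr Inl"])
     (simp_all add: hcat_def split: sum.split)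

lemma rank_vcat_commute: "rank (A /// B) = rank (B /// A)" for A :: "real^'n^'m"
  by (rule le_antisym; rule rank_reindex_le[where f="case_sum Inr Inl" and g=id])
     (simp_all add: vcat_def split: sum.split)

lemma rank_overlap_ge:
  fixes B11 B12 B21 b B23 B32 B33
  defines "r \<equiv> rank (overlap B11 B12 B21 b B23 B32 B33)"
  obtains "rank B11 + rank B33 + 2 \<le> r"
  | "rank (B11 ||| B12) + rank (B32 ||| B33) + 1 \<le> r"
  | "rank (B11 /// B21) + rank (B23 /// B33) + 1 \<le> r"
  | p where "rank ((B11 ||| B12) /// (B21 ||| entry p))
      + rank ((entry (b - p) ||| B23) /// (B32 ||| B33)) \<le> r"
proof -
  have rev: "rank (overlap B33 B32 B23 b B21 B12 B11) \<le> r"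
    unfolding r_def by (rule rank_overlap_reverse)
  let ?c1 = "\<exists>x. B12 = B11 ** x" and ?r1 = "\<exists>y. B21 = y ** B11"
    and ?c2 = "\<exists>x. B32 = B33 ** x" and ?r2 = "\<exists>y. B23 = y ** B33"
  have c1: "rank (B11 ||| B12) = (if ?c1 then rank B11 else rank B11 + 1)"
    and c2: "rank (B32 ||| B33) = (if ?c2 then rank B33 else rank B33 + 1)"
    and r1: "rank (B11 /// B21) = (if ?r1 then rank B11 else rank B11 + 1)"
    and r2: "rank (B23 /// B33) = (if ?r2 then rank B33 else rank B33 + 1)"
    by (simp_all add: rank_hcat_column rank_vcat_row rank_hcat_commute[of B32] rank_vcat_commute[of B23])
  \<comment> \<open>Outside the first two cases each end has an independent border. Either a column
    at one end pairs with a row at the other, or both ends fail only in columns or only in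
    rows.\<close>
  consider "?c1" "?r1" | "?c2" "?r2" | "\<not> ?c1" "\<not> ?r2" | "\<not> ?r1" "\<not> ?c2"
    | "\<not> ?c1" "?r1" "\<not> ?c2" "?r2" | "?c1" "\<not> ?r1" "?c2" "\<not> ?r2"
    by argo
  then show thesis
  proof cases
    case 1
    then obtain x y where "B12 = B11 ** x" "B21 = y ** B11" by blast
    from rank_overlap_ge_entry[OF this, where b=b and ?B23.0=B23 and ?B32.0=B32 and ?B33.0=B33]
    show thesis
      using that(4) unfolding r_def .
  next
    case 2
    then obtain x y where "B32 = B33 ** x" "B23 = y ** B33" by blast
    from rank_overlap_ge_entry[OF this, where b=b and ?B23.0=B21 and ?B32.0=B12 and ?B33.0=B11]
    obtain q where q: "rank ((B33 ||| B32) /// (B23 ||| entry q))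
      + rank ((entry (b - q) ||| B21) /// (B12 ||| B11)) \<le> rank (overlap B33 B32 B23 b B21 B12 B11)"
      by blast
    \<comment> \<open>Elimination with \<open>B33\<close> fixes the share \<open>q\<close> of the
      lower block, so the upper block receives \<open>b - q\<close>.\<close>
    have "rank ((B11 ||| B12) /// (B21 ||| entry (b - q)))
      + rank ((entry (b - (b - q)) ||| B23) /// (B32 ||| B33)) \<le> r"
      using q rev rank_overlap_reverse_entry[of B33 B32 B23 q]
        rank_overlap_reverse_entry[of B11 B12 B21 "b - q"]
      by simp
    then show thesis by (rule that(4))
  next
    case 3
    then have "rank B11 + rank B33 + 2 = rank (B11 ||| B12) + rank (B23 /// B33)"
      using c1 r2 by simp
    then show thesis
      using that(1) rank_overlap_ge_corners[of B11 B12 B23 B33 B21 b B32] by (simp add: r_def)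
  next
    case 4
    then have "rank B11 + rank B33 + 2 = rank (B33 ||| B32) + rank (B21 /// B11)"
      using c2 r1 by (simp add: rank_hcat_commute[of B33] rank_vcat_commute[of B21])
    then show thesis
      using that(1) rank_overlap_ge_corners[of B33 B32 B21 B11 B23 b B12] rev by linarith
  next
    case 5
    \<comment> \<open>Both bordering rows are dependent and leave the ranks of \<open>B11\<close>
      and \<open>B33\<close> unchanged; the extra one comes from the independent column
      \<open>B12\<close>.\<close>
    then have "rank (B11 /// B21) + rank (B23 /// B33) + 1 = rank (B11 ||| B12) + rank B33"
      using c1 r1 r2 by simp
    then show thesis
      using that(3) rank_overlap_ge_delete_row[of B11 B12 B33 B21 b B23 B32] by (simp add: r_def)
  next
    case 6
    then have "rank (B11 ||| B12) + rank (B32 ||| B33) + 1 = rank (B11 /// B21) + rank B33"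
      using c1 c2 r1 by simp
    then show thesis
      using that(2) rank_overlap_ge_delete_column[of B11 B21 B33 B12 b B23 B32] by (simp add: r_def)
  qed
qed

section \<open>Qualitative classes and minimum rank\<close>

text \<open>This makes the \<open>LEAST\<close> in \<open>mr\<close> attained and supplies the
  blocks that are filled in arbitrarily in the upper bounds.\<close>

lemma qual_class_nonempty: "\<exists>B. B \<in> qual_class A"
proof -
  have "\<exists>x. x \<in> sign_reals a" for a
    by (cases a) (auto intro: exI[of _ 1] exI[of _ "-1"])
  then have "(\<chi> i j. SOME x. x \<in> sign_reals (A $ i $ j)) \<in> qual_class A"
    by (auto simp: qual_class_def intro: someI_ex)
  then show ?thesis ..
qed

lemma mr_le: "B \<in> qual_class A \<Longrightarrow> mr A \<le> rank B"
  unfolding mr_def by (rule Least_le) blast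

lemma mr_attained: obtains B where "B \<in> qual_class A" "rank B = mr A"
proof -
  have "\<exists>B \<in> qual_class A. rank B = mr A"
    unfolding mr_def by (rule LeastI_ex) (use qual_class_nonempty in blast)
  then show thesis using that by blast
qed

lemma qual_class_hcat: "X ||| Y \<in> qual_class (A ||| B) \<longleftrightarrow> X \<in> qual_class A \<and> Y \<in> qual_class B"
  by (auto simp: qual_class_def all_sum)

lemma qual_class_vcat: "(X /// Y) \<in> qual_class (A /// B) \<longleftrightarrow> X \<in> qual_class A \<and> Y \<in> qual_class B"
  by (auto simp: qual_class_def all_sum)

lemma qual_class_entry: "entry x \<in> qual_class (entry a) \<longleftrightarrow> x \<in> sign_reals a"
  by (simp add: qual_class_def)

lemma qual_class_zero_block: "X \<in> qual_class zero_block \<longleftrightarrow> X = 0"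
  by (auto simp: qual_class_def zero_block_def vec_eq_iff)

lemmas qual_class_simps = qual_class_hcat qual_class_vcat qual_class_entry qual_class_zero_block

lemma qual_class_hcatE:
  assumes "Z \<in> qual_class (A ||| B)"
  obtains X Y where "Z = X ||| Y" "X \<in> qual_class A" "Y \<in> qual_class B"
  using assms qual_class_hcat hcat_exhaust by metis

lemma qual_class_vcatE:
  assumes "Z \<in> qual_class (A /// B)"
  obtains X Y where "Z = (X /// Y)" "X \<in> qual_class A" "Y \<in> qual_class B"
  using assms qual_class_vcat vcat_exhaust by metis

lemma qual_class_entryE:
  assumes "Z \<in> qual_class (entry a)"
  obtains x where "Z = entry x" "x \<in> sign_reals a"
  using assms qual_class_entry entry_eta by metis

lemma qual_class_scaleR: "B \<in> qual_class A \<Longrightarrow> c > 0 \<Longrightarrow> c *\<^sub>R B \<in> qual_class A"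
proof -
  have "c * x \<in> sign_reals a" if "x \<in> sign_reals a" "c > 0" for x a
    using that by (cases a) (auto simp: mult_pos_neg)
  then show "B \<in> qual_class A \<Longrightarrow> c > 0 \<Longrightarrow> c *\<^sub>R B \<in> qual_class A"
    by (simp add: qual_class_def)
qed

lemma scaleR_hcat: "c *\<^sub>R (A ||| B) = (c *\<^sub>R A) ||| (c *\<^sub>R B)"
  by (simp add: vec_eq_iff all_sum)

lemma scaleR_vcat: "c *\<^sub>R (A /// B) = ((c *\<^sub>R A) /// (c *\<^sub>R B))"
  by (simp add: vec_eq_iff all_sum)

lemma scaleR_entry: "c *\<^sub>R entry x = entry (c * x)"
  by (simp add: vec_eq_iff)

section \<open>Signs of differences\<close>

text \<open>For the lower bound: splitting a real corner produces a lower block of the pattern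
  \<open>S p\<close>. Equal nonzero signs give \<open>SHash\<close>, which imposes no
  condition.\<close>

lemma sign_diff_mem:
  assumes "a \<noteq> SHash" "p \<noteq> SHash" "z \<in> sign_reals a" "x \<in> sign_reals p"
  shows "z - x \<in> sign_reals (sign_diff a p)"
  using assms by (cases a; cases p) auto

text \<open>Scaling is what makes \<open>SHash\<close> harmless: when \<open>a = p\<close> the value \<open>y\<close> may have any sign, but
  a large multiple of \<open>x\<close> dominates it.\<close>

lemma sign_diff_scale:
  assumes "a \<noteq> SHash" "p \<noteq> SHash" "x \<in> sign_reals p" "y \<in> sign_reals (sign_diff a p)"
  obtains s t where "s > 0" "t > 0" "s * x + t * y \<in> sign_reals a"
proof -
  \<comment> \<open>The witness gives \<open>s * u = \<bar>v\<bar> + 1\<close>, which exceeds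
    \<open>- v\<close>.\<close>
  have dominate: "\<exists>s>0. s * u + v > 0" if "u > 0" for u v :: real
    by (rule exI[of _ "(\<bar>v\<bar> + 1) / u"]) (use that in \<open>auto simp: add_nonneg_pos\<close>)
  have balance: "\<exists>s>0. s * u + v = 0" if "u * v < 0" for u v :: real
    by (rule exI[of _ "- v / u"]) (use that in \<open>auto simp: mult_less_0_iff field_simps\<close>)
  \<comment> \<open>It suffices to scale one of the two summands; the other keeps the factor
    1.\<close>
  have "(\<exists>s>0. s * x + y \<in> sign_reals a) \<or> (\<exists>t>0. x + t * y \<in> sign_reals a)"
  proof (cases a; cases p)
    assume "a = SPlus" "p = SPlus"
    then show ?thesis using assms dominate[of x y] by auto
  next
    assume "a = SPlus" "p = SMinus"
    then show ?thesis using assms dominate[of y x] by (auto simp: add.commute)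
  next
    assume "a = SMinus" "p = SMinus"
    then show ?thesis using assms dominate[of "- x" "- y"] by auto
  next
    assume "a = SMinus" "p = SPlus"
    then show ?thesis using assms dominate[of "- y" "- x"] by (auto simp: add.commute)
  next
    assume "a = SZero" "p = SPlus"
    then show ?thesis using assms balance[of x y] by (auto simp: mult_pos_neg)
  next
    assume "a = SZero" "p = SMinus"
    then show ?thesis using assms balance[of x y] by (auto simp: mult_neg_pos)
  qed (use assms gt_ex[of "0 :: real"] in auto)
  then show thesis
    using that[of _ 1] that[of 1] by auto
qed

section \<open>Minimum rank of a sign pattern with overlapping diagonal blocks\<close>

theorem theorem6:
  fixes A11 :: "gsign^'n1^'m1" and A12 :: "gsign^1^'m1"
    and A21 :: "gsign^'n1^1" and a22 :: gsign and A23 :: "gsign^'n2^1"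
    and A32 :: "gsign^1^'m2" and A33 :: "gsign^'n2^'m2"
    and M :: "gsign^('n1 + 1 + 'n2)^('m1 + 1 + 'm2)"
    and R :: "gsign \<Rightarrow> gsign^('n1 + 1)^('m1 + 1)"
    and S :: "gsign \<Rightarrow> gsign^(1 + 'n2)^(1 + 'm2)"
  assumes M: "M = (A11 ||| A12 ||| zero_block) ///
                  (A21 ||| entry a22 ||| A23) ///
                  (zero_block ||| A32 ||| A33)"
    and "sign_pattern M"
    and R: "R = (\<lambda>p. (A11 ||| A12) ///
                     (A21 ||| entry p))"
    and S: "S = (\<lambda>p. (entry (sign_diff a22 p) ||| A23) ///
                     (A32 ||| A33))"
  shows "mr M = Min {mr A11 + mr A33 + 2,
                     mr (A11 ||| A12) + mr (A32 ||| A33) + 1,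
                     mr (A11 /// A21) + mr (A23 /// A33) + 1,
                     mr (R SPlus) + mr (S SPlus),
                     mr (R SZero) + mr (S SZero),
                     mr (R SMinus) + mr (S SMinus)}"
proof -
  have "M $ Inr (Inl 1) $ Inr (Inl 1) \<noteq> SHash"
    using \<open>sign_pattern M\<close> unfolding sign_pattern_def by (metis empty_iff gsign.distinct(5,9,11) insert_iff)
  then have a22: "a22 \<noteq> SHash"
    by (simp add: M)
  have overlap_mem: "overlap B11 B12 B21 b B23 B32 B33 \<in> qual_class M \<longleftrightarrow>
      B11 \<in> qual_class A11 \<and> B12 \<in> qual_class A12 \<and> B21 \<in> qual_class A21 \<and> b \<in> sign_reals a22
      \<and> B23 \<in> qual_class A23 \<and> B32 \<in> qual_class A32 \<and> B33 \<in> qual_class A33"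
    for B11 B12 B21 b B23 B32 B33
    by (auto simp: M overlap_def qual_class_simps)
  obtain b where b: "b \<in> sign_reals a22"
    using qual_class_nonempty[of "entry a22"] qual_class_entryE by metis
  \<comment> \<open>Minimal realisations of the blocks in the bound are completed by arbitrary
    entries of the right signs; the next two bounds proceed likewise.\<close>
  have le1: "mr M \<le> mr A11 + mr A33 + 2"
  proof -
    obtain B11 B33 where B: "B11 \<in> qual_class A11" "rank B11 = mr A11"
        "B33 \<in> qual_class A33" "rank B33 = mr A33"
      using mr_attained by metis
    obtain B12 B21 B23 B32 where "B12 \<in> qual_class A12" "B21 \<in> qual_class A21"
        "B23 \<in> qual_class A23" "B32 \<in> qual_class A32"
      using qual_class_nonempty by metis
    with B b have "overlap B11 B12 B21 b B23 B32 B33 \<in> qual_class M"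
      by (simp add: overlap_mem)
    from mr_le[OF this] rank_overlap_le_corners[of B11 B12 B21 b B23 B32 B33] B
    show ?thesis by linarith
  qed
  have le2: "mr M \<le> mr (A11 ||| A12) + mr (A32 ||| A33) + 1"
  proof -
    obtain X Y where XY: "X \<in> qual_class (A11 ||| A12)" "rank X = mr (A11 ||| A12)"
        "Y \<in> qual_class (A32 ||| A33)" "rank Y = mr (A32 ||| A33)"
      using mr_attained by metis
    obtain B11 B12 where X: "X = B11 ||| B12" "B11 \<in> qual_class A11" "B12 \<in> qual_class A12"
      using XY(1) by (rule qual_class_hcatE)
    obtain B32 B33 where Y: "Y = B32 ||| B33" "B32 \<in> qual_class A32" "B33 \<in> qual_class A33"
      using XY(3) by (rule qual_class_hcatE)
    obtain B21 B23 where "B21 \<in> qual_class A21" "B23 \<in> qual_class A23"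
      using qual_class_nonempty by metis
    with X Y b have "overlap B11 B12 B21 b B23 B32 B33 \<in> qual_class M"
      by (simp add: overlap_mem)
    from mr_le[OF this] rank_overlap_le_rows[of B11 B12 B21 b B23 B32 B33] XY X Y
    show ?thesis by simp
  qed
  have le3: "mr M \<le> mr (A11 /// A21) + mr (A23 /// A33) + 1"
  proof -
    obtain X Y where XY: "X \<in> qual_class (A11 /// A21)" "rank X = mr (A11 /// A21)"
        "Y \<in> qual_class (A23 /// A33)" "rank Y = mr (A23 /// A33)"
      using mr_attained by metis
    obtain B11 B21 where X: "X = (B11 /// B21)" "B11 \<in> qual_class A11" "B21 \<in> qual_class A21"
      using XY(1) by (rule qual_class_vcatE)
    obtain B23 B33 where Y: "Y = (B23 /// B33)" "B23 \<in> qual_class A23" "B33 \<in> qual_class A33"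
      using XY(3) by (rule qual_class_vcatE)
    obtain B12 B32 where "B12 \<in> qual_class A12" "B32 \<in> qual_class A32"
      using qual_class_nonempty by metis
    with X Y b have "overlap B11 B12 B21 b B23 B32 B33 \<in> qual_class M"
      by (simp add: overlap_mem)
    from mr_le[OF this] rank_overlap_le_columns[of B11 B12 B21 b B23 B32 B33] XY X Y
    show ?thesis by simp
  qed
  have le4: "mr M \<le> mr (R p) + mr (S p)" if p: "p \<noteq> SHash" for p
  proof -
    obtain X Y where XY: "X \<in> qual_class (R p)" "rank X = mr (R p)"
        "Y \<in> qual_class (S p)" "rank Y = mr (S p)"
      using mr_attained by metis
    obtain B11 B12 B21 x where X: "X = ((B11 ||| B12) /// (B21 ||| entry x))" "x \<in> sign_reals p"
      using XY(1) unfolding R by (elim qual_class_vcatE qual_class_hcatE qual_class_entryE) blast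
    obtain B23 B32 B33 y where Y: "Y = ((entry y ||| B23) /// (B32 ||| B33))"
        "y \<in> sign_reals (sign_diff a22 p)"
      using XY(3) unfolding S by (elim qual_class_vcatE qual_class_hcatE qual_class_entryE) blast
    \<comment> \<open>The corners of separately minimal realisations need not add up to the sign
      \<open>a22\<close>; positive rescaling repairs this and changes neither ranks nor
      signs.\<close>
    obtain s t where st: "s > 0" "t > 0" "s * x + t * y \<in> sign_reals a22"
      using sign_diff_scale[OF a22 p X(2) Y(2)] .
    have "s *\<^sub>R X \<in> qual_class (R p)" "t *\<^sub>R Y \<in> qual_class (S p)"
      using st XY qual_class_scaleR by blast+
    with st(3) have "overlap (s *\<^sub>R B11) (s *\<^sub>R B12) (s *\<^sub>R B21) (s * x + t * y)
        (t *\<^sub>R B23) (t *\<^sub>R B32) (t *\<^sub>R B33) \<in> qual_class M" (is "?B \<in> _")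
      by (simp add: overlap_mem X Y R S qual_class_simps scaleR_hcat scaleR_vcat scaleR_entry)
    then have "mr M \<le> rank ?B" by (rule mr_le)
    also have "\<dots> \<le> rank (s *\<^sub>R X) + rank (t *\<^sub>R Y)"
      unfolding X Y scaleR_hcat scaleR_vcat scaleR_entry by (rule rank_overlap_le_entry)
    finally show ?thesis
      using st XY by (simp add: rank_scaleR)
  qed
  obtain Z where Z: "Z \<in> qual_class M" "rank Z = mr M"
    using mr_attained by metis
  obtain X Y W where Z_split: "Z = (X /// Y /// W)" "X \<in> qual_class (A11 ||| A12 ||| zero_block)"
      "Y \<in> qual_class (A21 ||| entry a22 ||| A23)" "W \<in> qual_class (zero_block ||| A32 ||| A33)"
    using Z(1) unfolding M by (elim qual_class_vcatE) blast
  obtain B11 B12 where "X = B11 ||| B12 ||| 0"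
    using Z_split(2) by (elim qual_class_hcatE) (auto simp: qual_class_zero_block)
  moreover obtain B21 b B23 where "Y = B21 ||| entry b ||| B23"
    using Z_split(3) by (elim qual_class_hcatE qual_class_entryE) blast
  moreover obtain B32 B33 where "W = 0 ||| B32 ||| B33"
    using Z_split(4) by (elim qual_class_hcatE) (auto simp: qual_class_zero_block)
  ultimately have Z_eq: "Z = overlap B11 B12 B21 b B23 B32 B33"
    by (simp add: overlap_def Z_split(1))
  then have B: "B11 \<in> qual_class A11" "B12 \<in> qual_class A12" "B21 \<in> qual_class A21"
      "b \<in> sign_reals a22" "B23 \<in> qual_class A23" "B32 \<in> qual_class A32" "B33 \<in> qual_class A33"
    using Z(1) by (simp_all add: overlap_mem)
  \<comment> \<open>One listed term of size at most \<open>mr M\<close> bounds the minimum from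
    above.\<close>
  have "mr A11 + mr A33 + 2 \<le> mr M
      \<or> mr (A11 ||| A12) + mr (A32 ||| A33) + 1 \<le> mr M
      \<or> mr (A11 /// A21) + mr (A23 /// A33) + 1 \<le> mr M
      \<or> (\<exists>p\<in>{SPlus, SZero, SMinus}. mr (R p) + mr (S p) \<le> mr M)"
  proof (cases rule: rank_overlap_ge[of B11 B33 B12 B21 b B23 B32])
    case 1
    then show ?thesis
      using mr_le[OF B(1)] mr_le[OF B(7)] Z Z_eq by simp
  next
    case 2
    have "B11 ||| B12 \<in> qual_class (A11 ||| A12)" "B32 ||| B33 \<in> qual_class (A32 ||| A33)"
      using B by (simp_all add: qual_class_simps)
    from this[THEN mr_le] 2 show ?thesis using Z Z_eq by simp
  next
    case 3
    have "(B11 /// B21) \<in> qual_class (A11 /// A21)" "(B23 /// B33) \<in> qual_class (A23 /// A33)"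
      using B by (simp_all add: qual_class_simps)
    from this[THEN mr_le] 3 show ?thesis using Z Z_eq by simp
  next
    case (4 x)
    \<comment> \<open>\<open>p\<close> is the sign of the real number \<open>x\<close> at which the
      corner was split.\<close>
    obtain p where p: "p \<in> {SPlus, SZero, SMinus}" "x \<in> sign_reals p"
      using that[of SPlus] that[of SZero] that[of SMinus]
      by (cases x "0 :: real" rule: linorder_cases) simp_all
    then have "b - x \<in> sign_reals (sign_diff a22 p)"
      using sign_diff_mem[OF a22 _ B(4)] by auto
    then have "((B11 ||| B12) /// (B21 ||| entry x)) \<in> qual_class (R p)"
        "((entry (b - x) ||| B23) /// (B32 ||| B33)) \<in> qual_class (S p)"
      using B p by (simp_all add: R S qual_class_simps)
    from this[THEN mr_le] 4 p show ?thesis using Z Z_eq by fastforce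
  qed
  with le1 le2 le3 le4 show ?thesis
    by (intro antisym) (auto simp: Min_le_iff)
qed

end
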